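(* Fix an integer $k\ge1$. For each of the three families of graphs $G_q=\mathrm{Kn}(q,k)$, $G_q=J(q,k)$, and $G_q=K_q^k$ ($q\in\mathbb N$), the characteristic polynomial $p_{G_q}(n)=\det(nI-A_{G_q})$, where $A_{G_q}$ is the adjacency matrix of $G_q$, is a two-level polynomial of infinite depth.
   Context: $\mathbb N=\{0,1,2,\dots\}$, $[q]=\{1,\dots,q\}$. The Kneser graph $\mathrm{Kn}(q,k)$ has vertices the $k$-subsets of $[q]$, adjacent iff disjoint. The Johnson graph $J(q,k)$ has vertices the $k$-subsets of $[q]$, adjacent iff they share exactly $k-1$ elements. $K_q^k$ is the Cartesian product of $k$ copies of the complete graph $K_q$: vertex set $[q]^k$, two tuples adjacent iff they differ in exactly one coordinate. The determinant of the empty matrix is $1$. A numerical polynomial is $g\in\mathbb Q[x]$ with $g(q)\in\mathbb Z$ for all $q\in\mathbb Z$. Two-level polynomial: let $g$ be an eventually nonnegative numerical polynomial, $S=\{q\in\mathbb N: g(q)\ge0\}$, $e:S\to\mathbb N\cup\{-1,\infty\}$. A two-level polynomial of degree function $g$ and depth function $e$ is a sequence of polynomials $\{f_q\}_{q\in S}$, $f_q(n)$ of degree $g(q)$, such that, writing $f_q(n)=\sum_{r\ge0}c_r(q)n^{g(q)-r}$ with $c_r(q)=0$ for $r>g(q)$, there exist polynomials $\{\phi_r(q)\}_{r\ge0}$ with $c_r(q)=\phi_r(q)$ for every $q\in S$ and every $r\le e(q)$. Infinite depth means $e(q)=\infty$ for all $q\in S$, i.e. the equality holds for all $r\ge 0$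 (including $r>g(q)$, where $\phi_r(q)=0$). Here the degree function is the number of vertices of $G_q$. *)

theory Defs
  imports
    "Jordan_Normal_Form.Char_Poly"
    "Graph_Theory.Pair_Digraph"
    "HOL-Library.Extended_Real"
begin

section \<open>Graphs\<close>

text \<open>A finite simple graph is a finite, loop-free, symmetric digraph without multiple arcs
  (locale \<^locale>\<open>pair_graph\<close>); each edge is represented by its two arcs.\<close>

definition kneser_graph :: "nat \<Rightarrow> nat \<Rightarrow> nat set pair_pre_digraph" where
  "kneser_graph q k = (let V = {A. A \<subseteq> {1..q} \<and> card A = k} in
     \<lparr> pverts = V, parcs = {(A, B). A \<in> V \<and> B \<in> V \<and> A \<inter> B = {}} \<rparr>)"

definition johnson_graph :: "nat \<Rightarrow> nat \<Rightarrow> nat set pair_pre_digraph" where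
  "johnson_graph q k = (let V = {A. A \<subseteq> {1..q} \<and> card A = k} in
     \<lparr> pverts = V, parcs = {(A, B). A \<in> V \<and> B \<in> V \<and> card (A \<inter> B) = k - 1} \<rparr>)"

text \<open>The Cartesian product of \<open>k\<close> copies of the complete graph on \<open>{1..q}\<close>; a vertex is a
  \<open>k\<close>-tuple, represented as a list of length \<open>k\<close>.\<close>

definition complete_graph_power :: "nat \<Rightarrow> nat \<Rightarrow> nat list pair_pre_digraph" where
  "complete_graph_power q k = (let V = {xs. set xs \<subseteq> {1..q} \<and> length xs = k} in
     \<lparr> pverts = V,
       parcs = {(xs, ys). xs \<in> V \<and> ys \<in> V \<and> card {i. i < k \<and> xs ! i \<noteq> ys ! i} = 1} \<rparr>)"

lemma pair_graphI_pairs: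
  assumes "finite V"
    and sym: "\<And>u v. P u v \<Longrightarrow> P v u" and irr: "\<And>v. v \<in> V \<Longrightarrow> \<not> P v v"
  shows "pair_graph \<lparr> pverts = V, parcs = {(u, v). u \<in> V \<and> v \<in> V \<and> P u v} \<rparr>"
    (is "pair_graph ?G")
proof -
  have fin: "finite (parcs ?G)"
    by (rule finite_subset[of _ "V \<times> V"]) (use \<open>finite V\<close> in auto)
  have symm: "symmetric (with_proj ?G)"
    unfolding symmetric_def with_proj_simps by (rule symI) (use sym in simp)
  show ?thesis
  proof
    show "fst e \<in> pverts ?G" "snd e \<in> pverts ?G" "fst e \<noteq> snd e"
      if "e \<in> parcs ?G" for e
      using that irr by auto
  qed (use \<open>finite V\<close> fin symm in simp_all)
qed

lemma pair_graph_kneser: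
  assumes "1 \<le> k" shows "pair_graph (kneser_graph q k)"
  unfolding kneser_graph_def Let_def
proof (rule pair_graphI_pairs)
  show "finite {A. A \<subseteq> {1..q} \<and> card A = k}" by simp
qed (use assms in auto)

lemma pair_graph_johnson:
  assumes "1 \<le> k" shows "pair_graph (johnson_graph q k)"
  unfolding johnson_graph_def Let_def
proof (rule pair_graphI_pairs)
  show "finite {A. A \<subseteq> {1..q} \<and> card A = k}" by simp
  show "card (B \<inter> A) = k - 1" if "card (A \<inter> B) = k - 1" for A B :: "nat set"
    using that by (simp only: Int_commute)
qed (use assms in auto)

lemma pair_graph_complete_graph_power: "pair_graph (complete_graph_power q k)"
  unfolding complete_graph_power_def Let_def
proof (rule pair_graphI_pairs)
  show "finite {xs. set xs \<subseteq> {1..q} \<and> length xs = k}"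
    by (rule finite_lists_length_eq) simp
  show "card {i. i < k \<and> ys ! i \<noteq> xs ! i} = 1"
    if "card {i. i < k \<and> xs ! i \<noteq> ys ! i} = 1" for xs ys :: "nat list"
  proof -
    have "{i. i < k \<and> ys ! i \<noteq> xs ! i} = {i. i < k \<and> xs ! i \<noteq> ys ! i}"
      by metis
    with that show ?thesis by (simp only:)
  qed
qed simp

section \<open>The characteristic polynomial of a graph\<close>

definition adjacency_matrix ::
  "'v pair_pre_digraph \<Rightarrow> 'v list \<Rightarrow> 'a::zero_neq_one mat" where
  "adjacency_matrix G vs = mat (length vs) (length vs)
     (\<lambda>(i, j). if (vs ! i, vs ! j) \<in> parcs G then 1 else 0)"

text \<open>The enumeration of the vertices used here is immaterial, see
  \<open>graph_char_poly_eq\<close> below.\<close>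

definition graph_char_poly :: "'v pair_pre_digraph \<Rightarrow> 'a::comm_ring_1 poly" where
  "graph_char_poly G =
     char_poly (adjacency_matrix G (SOME vs. distinct vs \<and> set vs = pverts G))"

lemma char_poly_adjacency_matrix_cong:
  assumes "distinct vs" "distinct ws" "set vs = set ws"
  shows "char_poly (adjacency_matrix G vs :: 'a::comm_ring_1 mat) =
         char_poly (adjacency_matrix G ws)"
proof -
  define n where "n = length ws"
  have "mset vs = mset ws"
    using assms set_eq_iff_mset_eq_distinct by blast
  then obtain p where p: "p permutes {..<length ws}" and vs: "permute_list p ws = vs"
    by (rule mset_eq_permutation)
  have len: "length vs = n" "length ws = n"
    unfolding n_def using vs[symmetric] by simp_all
  have nth: "vs ! i = ws ! p i" if "i < n" for i
    unfolding vs[symmetric] by (rule permute_list_nth[OF p]) (use that len in simp)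
  have pn: "p permutes {0..<n}"
    using p by (simp only: n_def atLeast0LessThan)
  then have p_lt: "p i < n" if "i < n" for i
    using that permutes_in_image[OF pn, of i] by simp
  have p_inj: "p i = p j \<longleftrightarrow> i = j" for i j
    using permutes_inj[OF pn] by (rule inj_eq)
  define B where "B = char_poly_matrix (adjacency_matrix G ws :: 'a mat)"
  define C where "C = mat n n (\<lambda>(i, j). B $$ (p i, j))"
  have B: "B \<in> carrier_mat n n"
    by (auto simp: B_def char_poly_matrix_def adjacency_matrix_def len)
  have C: "C \<in> carrier_mat n n"
    by (simp add: C_def)
  have "char_poly_matrix (adjacency_matrix G vs :: 'a mat) =
        transpose_mat (mat n n (\<lambda>(i, j). transpose_mat C $$ (p i, j)))"
    by (rule eq_matI)
      (auto simp: B_def C_def char_poly_matrix_def adjacency_matrix_def len nth p_lt p_inj)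
  then have "char_poly (adjacency_matrix G vs :: 'a mat) = signof p * det (transpose_mat C)"
    using C by (simp add: char_poly_def det_transpose[of _ n] det_permute_rows[OF _ pn])
  also have "\<dots> = signof p * (signof p * det B)"
    using C B pn by (simp add: det_transpose[of _ n] C_def det_permute_rows[OF _ pn])
  also have "\<dots> = det B"
    by (simp add: sign_def)
  finally show ?thesis
    by (simp add: B_def char_poly_def)
qed

lemma graph_char_poly_eq:
  assumes "distinct vs" "set vs = pverts G"
  shows "graph_char_poly G = char_poly (adjacency_matrix G vs)"
proof -
  let ?ws = "SOME ws. distinct ws \<and> set ws = pverts G"
  have "distinct ?ws \<and> set ?ws = pverts G"
    by (rule someI[of _ vs]) (use assms in simp)
  with assms show ?thesis
    unfolding graph_char_poly_def by (intro char_poly_adjacency_matrix_cong) auto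
qed

section \<open>Two-level polynomials\<close>

definition numerical_polynomial :: "rat poly \<Rightarrow> bool" where
  "numerical_polynomial g \<longleftrightarrow> (\<forall>q::int. poly g (of_int q) \<in> \<int>)"

definition level_set :: "rat poly \<Rightarrow> nat set" where
  "level_set g = {q. poly g (of_nat q) \<ge> 0}"

text \<open>\<open>codeg_coeff f r\<close> is the coefficient of \<open>n ^ (degree f - r)\<close> in \<open>f\<close>, and \<open>0\<close> for
  \<open>r > degree f\<close>.\<close>

definition codeg_coeff :: "'a::zero poly \<Rightarrow> nat \<Rightarrow> 'a" where
  "codeg_coeff f r = (if r \<le> degree f then coeff f (degree f - r) else 0)"

text \<open>Only the values of \<open>e\<close> and \<open>f\<close> on \<open>level_set g\<close> matter. The zero polynomial has no degree
  here, although \<open>degree 0 = 0\<close> in the library.\<close>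

definition two_level_polynomial ::
  "rat poly \<Rightarrow> (nat \<Rightarrow> ereal) \<Rightarrow> (nat \<Rightarrow> rat poly) \<Rightarrow> bool" where
  "two_level_polynomial g e f \<longleftrightarrow>
     numerical_polynomial g \<and>
     (\<forall>\<^sub>F q in sequentially. poly g (of_nat q) \<ge> 0) \<and>
     (\<forall>q\<in>level_set g. e q \<in> range (\<lambda>m::nat. ereal (real m)) \<union> {-1, \<infinity>}) \<and>
     (\<forall>q\<in>level_set g. f q \<noteq> 0 \<and> of_nat (degree (f q)) = poly g (of_nat q)) \<and>
     (\<exists>\<phi> :: nat \<Rightarrow> rat poly. \<forall>q\<in>level_set g. \<forall>r. ereal (real r) \<le> e q \<longrightarrow>
        codeg_coeff (f q) r = poly (\<phi> r) (of_nat q))"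

end

theory Submission
  imports Defs
begin

text \<open>No eigenvalues are needed: the coefficients are read off the Leibniz expansion of
  \<open>det (x I - A)\<close>. Since \<open>A\<close> has zero diagonal, a permutation \<open>p\<close> of the vertices that moves
  exactly \<open>r\<close> of them contributes to the coefficient of \<open>x ^ (N - r)\<close> only, where \<open>N\<close> is the number
  of vertices. Hence that coefficient is the sum, over all permutations moving exactly \<open>r\<close> vertices,
  of the sign times the product of the entries of \<open>- A\<close> over the moved vertices
  (\<open>codeg_coeff_graph_char_poly\<close>). For \<open>r > N\<close> there are no such permutations, and the coefficient
  is \<open>0\<close> by convention, so the formula holds for every \<open>r\<close>.

  In each of the three families a vertex carries at most \<open>k\<close> labels from \<open>{1..q}\<close>: the elements of
  the set or the entries of the tuple. A permutation moving \<open>r\<close> vertices thus involves a set \<open>U\<close> of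
  at most \<open>r * k\<close> labels. Group the permutations according to \<open>U\<close>. The sum over one group does not
  mention \<open>q\<close>, and it depends on the cardinality of \<open>U\<close> only, because relabelling the vertices
  along a bijection of the labels is a graph isomorphism (\<open>spanning_sum_card\<close>). With \<open>F r m\<close> the
  common value of the group sums for \<open>card U = m\<close>, the coefficient is therefore
  \<open>\<Sum>m\<le>r * k. (q choose m) * F r m\<close> (\<open>sum_perm_weight_vertices\<close>), a polynomial in \<open>q\<close>.

  The locale \<open>labelled_relation\<close> collects what this argument uses about the vertices, their labels
  and the adjacency, so that it is carried out once for all three families.\<close>

section \<open>Binomial coefficients as rational polynomials\<close>

definition binomial_poly :: "nat \<Rightarrow> rat poly" where
  "binomial_poly m = Polynomial.smult (1 / fact m) (\<Prod>i<m. [:- of_nat i, 1:])"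

lemma poly_binomial_poly: "poly (binomial_poly m) x = x gchoose m"
  by (simp add: binomial_poly_def poly_prod gbinomial_prod_rev atLeast0LessThan)

lemma poly_binomial_poly_of_nat: "poly (binomial_poly m) (of_nat q) = of_nat (q choose m)"
  by (simp add: poly_binomial_poly binomial_gbinomial)

lemma numerical_binomial_poly: "numerical_polynomial (binomial_poly m)"
  unfolding numerical_polynomial_def poly_binomial_poly
  by (simp flip: of_int_gbinomial)

lemma sum_Pow_card:
  fixes f :: "nat \<Rightarrow> 'a::comm_ring_1"
  assumes "finite T"
  shows "(\<Sum>U\<in>Pow T. f (card U)) = (\<Sum>m\<le>card T. of_nat (card T choose m) * f m)"
proof -
  have "(\<Sum>U\<in>Pow T. f (card U)) = (\<Sum>m\<le>card T. \<Sum>U\<in>{U \<in> Pow T. card U = m}. f (card U))"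
    by (rule sum.group[symmetric]) (use assms card_mono in auto)
  also have "\<dots> = (\<Sum>m\<le>card T. of_nat (card {U. U \<subseteq> T \<and> card U = m}) * f m)"
    by (rule sum.cong) auto
  finally show ?thesis
    by (simp add: n_subsets assms)
qed

section \<open>Transport of permutations\<close>

definition moved :: "('a \<Rightarrow> 'a) \<Rightarrow> 'a set" where
  "moved p = {x. p x \<noteq> x}"

text \<open>The contribution of \<open>p\<close> to the Leibniz expansion of \<open>det (x I - A)\<close>, with the factors \<open>x\<close> of
  the fixed points removed; \<open>A\<close> is the 0-1 matrix of the relation \<open>E\<close>. The product extends over
  the moved points only, so the value does not depend on the finite set on which \<open>p\<close> is regarded
  as a permutation.\<close>

definition perm_weight :: "('a \<times> 'a) set \<Rightarrow> ('a \<Rightarrow> 'a) \<Rightarrow> 'b::comm_ring_1" where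
  "perm_weight E p = of_int (sign p) * (\<Prod>x\<in>moved p. if (x, p x) \<in> E then - 1 else 0)"

lemma moved_subset: "p permutes A \<Longrightarrow> moved p \<subseteq> A"
  by (auto simp: moved_def permutes_def)

lemma bij_betw_map_permutation:
  assumes "bij_betw f A B"
  shows "bij_betw (map_permutation A f) {p. p permutes A} {p. p permutes B}"
proof -
  have "f ` A = B"
    using assms by (simp add: bij_betw_def)
  then have "map_permutation A f = (\<lambda>p x. if x \<in> B then f (p (inv_into A f x)) else x)"
    by (simp add: fun_eq_iff map_permutation_def restrict_id_def)
  then show ?thesis
    using bij_betw_permutations[OF assms] by simp
qed

lemma moved_map_permutation:
  assumes "inj_on f A" "p permutes A"
  shows "moved (map_permutation A f p) = f ` moved p"
proof -
  have in_image: "x \<in> f ` A" if "map_permutation A f p x \<noteq> x" for x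
    using that by (auto simp: map_permutation_def restrict_id_def split: if_splits)
  have step: "map_permutation A f p (f x) \<noteq> f x \<longleftrightarrow> p x \<noteq> x" if "x \<in> A" for x
    using that assms
    by (simp add: map_permutation_apply inj_on_eq_iff permutes_in_image)
  show ?thesis
    using in_image step moved_subset[OF assms(2)] by (fastforce simp: moved_def)
qed

text \<open>Conjugation by an injection preserves signs, and it preserves entries as soon as the injection
  respects the relations. This serves twice: to pass from matrix indices to vertices, and to compare
  permutations that involve different sets of labels.\<close>

lemma perm_weight_map_permutation:
  assumes f: "inj_on f A" and p: "p permutes A" and "finite A"
    and E: "\<And>x y. x \<in> A \<Longrightarrow> y \<in> A \<Longrightarrow> (f x, f y) \<in> E' \<longleftrightarrow> (x, y) \<in> E"
  shows "perm_weight E' (map_permutation A f p) = perm_weight E p"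
proof -
  have sub: "moved p \<subseteq> A"
    by (rule moved_subset[OF p])
  have "(\<Prod>x\<in>f ` moved p. if (x, map_permutation A f p x) \<in> E' then - 1 else 0) =
        (\<Prod>x\<in>moved p. if (x, p x) \<in> E then - 1 else (0::'c))"
    by (subst prod.reindex[OF inj_on_subset[OF f sub]], rule prod.cong)
      (use sub p in \<open>auto simp: map_permutation_apply[OF f] E permutes_in_image\<close>)
  then show ?thesis
    using assms by (simp add: perm_weight_def moved_map_permutation sign_map_permutation)
qed

section \<open>Coefficients of the characteristic polynomial of a graph\<close>

lemma adjacency_matrix_carrier: "adjacency_matrix G vs \<in> carrier_mat (length vs) (length vs)"
  by (simp add: adjacency_matrix_def)

lemma degree_graph_char_poly:
  assumes "finite (pverts G)"
  shows "degree (graph_char_poly G :: 'a::comm_ring_1 poly) = card (pverts G)"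
    and "graph_char_poly G \<noteq> (0 :: 'a poly)"
proof -
  obtain vs where vs: "distinct vs" "set vs = pverts G"
    using finite_distinct_list[OF assms] by blast
  have "length vs = card (pverts G)"
    using vs distinct_card by metis
  then have "monic (graph_char_poly G :: 'a poly)"
    and deg: "degree (graph_char_poly G :: 'a poly) = card (pverts G)"
    using degree_monic_char_poly[of "adjacency_matrix G vs :: 'a mat", OF adjacency_matrix_carrier]
    by (simp_all add: graph_char_poly_eq[OF vs])
  then show "graph_char_poly G \<noteq> (0 :: 'a poly)"
    by auto
  show "degree (graph_char_poly G :: 'a poly) = card (pverts G)"
    by (rule deg)
qed

text \<open>A fixed point of \<open>p\<close> meets the diagonal of \<open>x I - A\<close>, whose entries are all equal to \<open>x\<close> in
  the absence of loops; a moved point meets a constant entry. So every term of the Leibniz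
  expansion is a monomial.\<close>

lemma graph_char_poly_expansion:
  assumes fin: "finite (pverts G)" and loopless: "\<And>v. (v, v) \<notin> parcs G"
  shows "graph_char_poly G = (\<Sum>p | p permutes pverts G.
    monom (perm_weight (parcs G) p :: 'a::comm_ring_1) (card (pverts G) - card (moved p)))"
proof -
  obtain vs where vs: "distinct vs" "set vs = pverts G"
    using finite_distinct_list[OF fin] by blast
  define n where "n = length vs"
  define I where "I = {0..<n}"
  have [simp]: "finite I" "card I = n"
    by (simp_all add: I_def)
  define M where "M = char_poly_matrix (adjacency_matrix G vs :: 'a mat)"
  define E where "E = {(i, j). (vs ! i, vs ! j) \<in> parcs G}"
  have n: "n = card (pverts G)"
    using vs distinct_card n_def by metis
  have bij: "bij_betw ((!) vs) I (pverts G)"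
    unfolding I_def atLeast0LessThan by (rule bij_betw_nth) (use vs n_def in auto)
  then have inj: "inj_on ((!) vs) I"
    by (simp add: bij_betw_def)
  have entry: "M $$ (i, j) = (if i = j then monom 1 1 else [:if (i, j) \<in> E then - 1 else 0:])"
    if "i \<in> I" "j \<in> I" for i j
    using that loopless
    by (auto simp: M_def E_def I_def n_def char_poly_matrix_def adjacency_matrix_def monom_altdef)
  have diag: "(\<Prod>i\<in>I. M $$ (i, p i)) =
      monom (\<Prod>i\<in>moved p. if (i, p i) \<in> E then - 1 else 0) (n - card (moved p))"
    if p: "p permutes I" for p
  proof -
    have sub: "moved p \<subseteq> I"
      by (rule moved_subset[OF p])
    have pI: "p i \<in> I" if "i \<in> I" for i
      using that p by (simp add: permutes_in_image)
    have "(\<Prod>i\<in>I. M $$ (i, p i)) = (\<Prod>i\<in>I - moved p. M $$ (i, p i)) * (\<Prod>i\<in>moved p. M $$ (i, p i))"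
      by (rule prod.subset_diff) (use sub in auto)
    also have "(\<Prod>i\<in>I - moved p. M $$ (i, p i)) = (\<Prod>i\<in>I - moved p. monom 1 1)"
      by (rule prod.cong) (auto simp: moved_def entry)
    also have "\<dots> = monom 1 (n - card (moved p))"
      using sub by (simp add: card_Diff_subset finite_subset[OF sub] monom_power)
    also have "(\<Prod>i\<in>moved p. M $$ (i, p i)) =
        (\<Prod>i\<in>moved p. [:if (i, p i) \<in> E then - 1 else 0:])"
      by (rule prod.cong) (use sub pI entry in \<open>auto simp: moved_def\<close>)
    also have "\<dots> = [:\<Prod>i\<in>moved p. if (i, p i) \<in> E then - 1 else 0:]"
      using finite_subset[OF sub \<open>finite I\<close>] by (induction rule: finite_induct) auto
    finally show ?thesis
      by (simp add: mult_monom monom_0[symmetric])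
  qed
  have "graph_char_poly G = det M"
    by (simp add: graph_char_poly_eq[OF vs] char_poly_def M_def)
  also have "\<dots> = (\<Sum>p | p permutes I. signof p * (\<Prod>i\<in>I. M $$ (i, p i)))"
    unfolding I_def
    by (rule det_def') (simp add: M_def n_def adjacency_matrix_carrier)
  also have "\<dots> = (\<Sum>p | p permutes I. monom (perm_weight E p) (n - card (moved p)))"
    by (rule sum.cong) (auto simp: diag perm_weight_def sign_def minus_monom)
  also have "\<dots> = (\<Sum>p | p permutes I.
      monom (perm_weight (parcs G) (map_permutation I ((!) vs) p))
        (n - card (moved (map_permutation I ((!) vs) p))))"
  proof (rule sum.cong)
    fix p assume "p \<in> {p. p permutes I}"
    then have p: "p permutes I"
      by simp
    have "card (moved (map_permutation I ((!) vs) p)) = card (moved p)"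
      unfolding moved_map_permutation[OF inj p]
      by (rule card_image[OF inj_on_subset[OF inj moved_subset[OF p]]])
    moreover have "perm_weight (parcs G) (map_permutation I ((!) vs) p) = (perm_weight E p :: 'a)"
      by (rule perm_weight_map_permutation[OF inj p]) (auto simp: E_def)
    ultimately show "monom (perm_weight E p :: 'a) (n - card (moved p)) =
      monom (perm_weight (parcs G) (map_permutation I ((!) vs) p))
        (n - card (moved (map_permutation I ((!) vs) p)))"
      by simp
  qed simp
  also have "\<dots> = (\<Sum>p | p permutes pverts G.
      monom (perm_weight (parcs G) p) (n - card (moved p)))"
    by (rule sum.reindex_bij_betw[OF bij_betw_map_permutation[OF bij]])
  finally show ?thesis
    by (simp only: n)
qed

text \<open>For \<open>r\<close> beyond the number of vertices both sides vanish, the right one as an empty sum. This is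
  what makes the depth infinite.\<close>

lemma codeg_coeff_graph_char_poly:
  assumes fin: "finite (pverts G)" and loopless: "\<And>v. (v, v) \<notin> parcs G"
  shows "codeg_coeff (graph_char_poly G) r =
    (\<Sum>p | p permutes pverts G \<and> card (moved p) = r. perm_weight (parcs G) p :: 'a::comm_ring_1)"
proof -
  have finP: "finite {p. p permutes pverts G}"
    by (rule finite_permutations[OF fin])
  have le: "card (moved p) \<le> card (pverts G)" if "p permutes pverts G" for p
    by (rule card_mono[OF fin moved_subset[OF that]])
  show ?thesis
  proof (cases "r \<le> card (pverts G)")
    case True
    then have "codeg_coeff (graph_char_poly G :: 'a poly) r =
        poly.coeff (graph_char_poly G) (card (pverts G) - r)"
      by (simp add: codeg_coeff_def degree_graph_char_poly[OF fin])
    also have "\<dots> = (\<Sum>p | p permutes pverts G.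
        poly.coeff (monom (perm_weight (parcs G) p) (card (pverts G) - card (moved p)))
          (card (pverts G) - r))"
      by (simp only: graph_char_poly_expansion[OF assms] coeff_sum)
    also have "\<dots> = (\<Sum>p | p permutes pverts G.
        if card (moved p) = r then perm_weight (parcs G) p else 0)"
    proof (rule sum.cong[OF refl])
      fix p assume "p \<in> {p. p permutes pverts G}"
      with le have "card (moved p) \<le> card (pverts G)"
        by simp
      with True have "card (pverts G) - card (moved p) = card (pverts G) - r \<longleftrightarrow> card (moved p) = r"
        by arith
      then show "poly.coeff (monom (perm_weight (parcs G) p :: 'a) (card (pverts G) - card (moved p)))
          (card (pverts G) - r) = (if card (moved p) = r then perm_weight (parcs G) p else 0)"
        by simp
    qed
    also have "\<dots> = (\<Sum>p\<in>{p \<in> {p. p permutes pverts G}. card (moved p) = r}. perm_weight (parcs G) p)"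
      by (rule sum.inter_filter[OF finP, symmetric])
    finally show ?thesis
      by simp
  next
    case False
    then have empty: "{p. p permutes pverts G \<and> card (moved p) = r} = {}"
      using le by auto
    show ?thesis
      unfolding empty using False by (simp add: codeg_coeff_def degree_graph_char_poly[OF fin])
  qed
qed

section \<open>Permutations with a prescribed image\<close>

lemma ex_bij_image_eq:
  fixes U V :: "'a set"
  assumes "finite U" "finite V" "card U = card V"
  shows "\<exists>\<sigma>. bij \<sigma> \<and> \<sigma> ` U = V"
proof -
  let ?S = "U \<union> V"
  obtain f where f: "bij_betw f U V"
    using finite_same_card_bij[OF assms] by blast
  have "card (?S - U) = card (?S - V)"
    using assms by (simp add: card_Diff_subset)
  then obtain g where g: "bij_betw g (?S - U) (?S - V)"
    using finite_same_card_bij[of "?S - U" "?S - V"] assms by blast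
  \<comment> \<open>The remainders \<open>V - U\<close> and \<open>U - V\<close> have the same size, so \<open>f\<close> extends to a permutation
    of \<open>U \<union> V\<close>.\<close>
  define \<sigma> where "\<sigma> x = (if x \<in> U then f x else if x \<in> V then g x else x)" for x
  have "bij_betw \<sigma> U V"
    using f by (rule bij_betw_cong[THEN iffD1, rotated]) (simp add: \<sigma>_def)
  moreover have "bij_betw \<sigma> (?S - U) (?S - V)"
    using g by (rule bij_betw_cong[THEN iffD1, rotated]) (auto simp: \<sigma>_def)
  ultimately have "bij_betw \<sigma> (U \<union> (?S - U)) (V \<union> (?S - V))"
    by (rule bij_betw_combine) auto
  moreover have "U \<union> (?S - U) = ?S" "V \<union> (?S - V) = ?S"
    by auto
  ultimately have "bij_betw \<sigma> ?S ?S"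
    by simp
  then have "\<sigma> permutes ?S"
    by (rule bij_imp_permutes) (auto simp: \<sigma>_def)
  then have "bij \<sigma>"
    by (rule permutes_bij)
  with \<open>bij_betw \<sigma> U V\<close> show ?thesis
    by (auto simp: bij_betw_def)
qed

section \<open>Graphs on labelled objects\<close>

text \<open>A relation on objects that carry at most \<open>k\<close> natural numbers as labels, invariant under
  relabelling along any permutation of the natural numbers. Labels range over the whole of \<open>nat\<close> so that
  one relation serves for all members of the family; a member is the restriction to the objects with
  labels in a finite set.\<close>

locale labelled_relation =
  fixes W :: "'v set" and E :: "('v \<times> 'v) set"
    and labels :: "'v \<Rightarrow> nat set" and relabel :: "(nat \<Rightarrow> nat) \<Rightarrow> 'v \<Rightarrow> 'v" and k :: nat
  assumes finite_labelled: "finite U \<Longrightarrow> finite {v \<in> W. labels v \<subseteq> U}"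
    and card_labels: "v \<in> W \<Longrightarrow> card (labels v) \<le> k"
    and loopless: "(v, v) \<notin> E"
    and relabel_in: "bij \<sigma> \<Longrightarrow> v \<in> W \<Longrightarrow> relabel \<sigma> v \<in> W"
    and labels_relabel: "bij \<sigma> \<Longrightarrow> v \<in> W \<Longrightarrow> labels (relabel \<sigma> v) = \<sigma> ` labels v"
    and relabel_inv: "bij \<sigma> \<Longrightarrow> v \<in> W \<Longrightarrow> relabel (inv_into UNIV \<sigma>) (relabel \<sigma> v) = v"
    and relabel_arcs: "bij \<sigma> \<Longrightarrow> u \<in> W \<Longrightarrow> v \<in> W \<Longrightarrow>
      (relabel \<sigma> u, relabel \<sigma> v) \<in> E \<longleftrightarrow> (u, v) \<in> E"
begin

definition vertices :: "nat set \<Rightarrow> 'v set" where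
  "vertices U = {v \<in> W. labels v \<subseteq> U}"

text \<open>Any permutation of \<open>vertices T\<close> whose moved vertices have exactly the labels \<open>U\<close> is also a
  permutation of \<open>vertices U\<close>. So, as \<open>U\<close> ranges over the subsets of \<open>T\<close>, these sets partition
  the permutations of \<open>vertices T\<close> that move \<open>r\<close> vertices, and none of them mentions \<open>T\<close>.\<close>

definition spanning_perms :: "nat \<Rightarrow> nat set \<Rightarrow> ('v \<Rightarrow> 'v) set" where
  "spanning_perms r U =
     {p. p permutes vertices U \<and> card (moved p) = r \<and> (\<Union>v\<in>moved p. labels v) = U}"

definition spanning_sum :: "nat \<Rightarrow> nat set \<Rightarrow> 'b::comm_ring_1" where
  "spanning_sum r U = (\<Sum>p\<in>spanning_perms r U. perm_weight E p)"

lemma finite_vertices: "finite U \<Longrightarrow> finite (vertices U)"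
  by (simp add: vertices_def finite_labelled)

lemma bij_betw_relabel:
  assumes \<sigma>: "bij \<sigma>"
  shows "bij_betw (relabel \<sigma>) (vertices U) (vertices (\<sigma> ` U))"
proof (rule bij_betw_byWitness[where f' = "relabel (inv_into UNIV \<sigma>)"])
  have inv: "bij (inv_into UNIV \<sigma>)" "inv_into UNIV (inv_into UNIV \<sigma>) = \<sigma>"
    using \<sigma> by (simp_all add: bij_imp_bij_inv inv_inv_eq)
  show "\<forall>v\<in>vertices U. relabel (inv_into UNIV \<sigma>) (relabel \<sigma> v) = v"
    using \<sigma> by (simp add: vertices_def relabel_inv)
  show "\<forall>v\<in>vertices (\<sigma> ` U). relabel \<sigma> (relabel (inv_into UNIV \<sigma>) v) = v"
    using relabel_inv[OF inv(1)] by (simp add: vertices_def inv)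
  show "relabel \<sigma> ` vertices U \<subseteq> vertices (\<sigma> ` U)"
    using \<sigma> by (fastforce simp: vertices_def relabel_in labels_relabel)
  have "inv_into UNIV \<sigma> ` \<sigma> ` U = U"
    using \<sigma> by (simp add: image_comp bij_is_inj)
  then show "relabel (inv_into UNIV \<sigma>) ` vertices (\<sigma> ` U) \<subseteq> vertices U"
    using inv by (fastforce simp: vertices_def relabel_in labels_relabel)
qed

text \<open>Conjugation with the relabelling is a bijection between the two sets of permutations that
  preserves weights.\<close>

lemma spanning_sum_relabel:
  assumes \<sigma>: "bij \<sigma>" and "finite U"
  shows "spanning_sum r (\<sigma> ` U) = spanning_sum r U"
proof -
  let ?c = "map_permutation (vertices U) (relabel \<sigma>)"
  note bij = bij_betw_relabel[OF \<sigma>, of U]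
  then have inj: "inj_on (relabel \<sigma>) (vertices U)"
    by (simp add: bij_betw_def)
  have moved: "card (moved (?c p)) = card (moved p)"
    "(\<Union>v\<in>moved (?c p). labels v) = \<sigma> ` (\<Union>v\<in>moved p. labels v)"
    if p: "p permutes vertices U" for p
  proof -
    show "card (moved (?c p)) = card (moved p)"
      unfolding moved_map_permutation[OF inj p]
      by (rule card_image[OF inj_on_subset[OF inj moved_subset[OF p]]])
    have "labels (relabel \<sigma> v) = \<sigma> ` labels v" if "v \<in> moved p" for v
      using moved_subset[OF p] that \<sigma> by (auto simp: vertices_def intro!: labels_relabel)
    then show "(\<Union>v\<in>moved (?c p). labels v) = \<sigma> ` (\<Union>v\<in>moved p. labels v)"
      by (simp add: moved_map_permutation[OF inj p] image_UN)
  qed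
  have "bij_betw ?c
      {p \<in> {p. p permutes vertices U}. card (moved p) = r \<and> (\<Union>v\<in>moved p. labels v) = U}
      {p \<in> {p. p permutes vertices (\<sigma> ` U)}. card (moved p) = r \<and> (\<Union>v\<in>moved p. labels v) = \<sigma> ` U}"
    by (rule bij_betw_Collect[OF bij_betw_map_permutation[OF bij]])
      (use \<sigma> in \<open>simp add: moved inj_image_eq_iff bij_is_inj\<close>)
  then have "bij_betw ?c (spanning_perms r U) (spanning_perms r (\<sigma> ` U))"
    by (simp add: spanning_perms_def)
  from sum.reindex_bij_betw[OF this, symmetric]
  have "spanning_sum r (\<sigma> ` U) = (\<Sum>p\<in>spanning_perms r U. perm_weight E (?c p) :: 'a)"
    unfolding spanning_sum_def .
  also have "\<dots> = spanning_sum r U"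
    unfolding spanning_sum_def
    by (rule sum.cong[OF refl], rule perm_weight_map_permutation[OF inj _ finite_vertices[OF \<open>finite U\<close>]])
      (simp_all add: spanning_perms_def vertices_def relabel_arcs[OF \<sigma>])
  finally show ?thesis .
qed

lemma spanning_sum_card:
  assumes "finite U"
  shows "spanning_sum r U = spanning_sum r {1..card U}"
proof -
  obtain \<sigma> where "bij \<sigma>" "\<sigma> ` U = {1..card U}"
    using ex_bij_image_eq[of U "{1..card U}"] assms by auto
  then show ?thesis
    using spanning_sum_relabel[OF _ assms] by metis
qed

text \<open>The labels of \<open>r\<close> vertices number at most \<open>r * k\<close>. This bounds the degree in \<open>q\<close> of the
  coefficients independently of \<open>q\<close>.\<close>

lemma spanning_sum_eq_0:
  assumes "finite U" and "r * k < card U"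
  shows "spanning_sum r U = 0"
proof -
  have "card U \<le> r * k" if "p \<in> spanning_perms r U" for p
  proof -
    from that have p: "p permutes vertices U" and r: "card (moved p) = r"
      and U: "(\<Union>v\<in>moved p. labels v) = U"
      by (auto simp: spanning_perms_def)
    have "card U \<le> (\<Sum>v\<in>moved p. card (labels v))"
      unfolding U[symmetric]
      by (rule card_UN_le)
        (use finite_subset[OF moved_subset[OF p] finite_vertices[OF \<open>finite U\<close>]] in auto)
    also have "\<dots> \<le> (\<Sum>v\<in>moved p. k)"
      by (rule sum_mono) (use moved_subset[OF p] in \<open>auto simp: vertices_def card_labels\<close>)
    finally show ?thesis
      by (simp add: r)
  qed
  then have "spanning_perms r U = {}"
    using assms(2) by fastforce
  then show ?thesis
    by (simp add: spanning_sum_def)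
qed

text \<open>The right-hand side depends on \<open>T\<close> through binomial coefficients in \<open>card T\<close> alone, and the
  range of summation does not grow with \<open>T\<close>; so it is a polynomial in \<open>card T\<close>.\<close>

lemma sum_perm_weight_vertices:
  assumes "finite T"
  shows "(\<Sum>p | p permutes vertices T \<and> card (moved p) = r. perm_weight E p :: 'b::comm_ring_1) =
    (\<Sum>m\<le>r * k. of_nat (card T choose m) * spanning_sum r {1..m})"
    (is "sum _ ?P = _")
proof -
  let ?f = "\<lambda>m. of_nat (card T choose m) * spanning_sum r {1..m} :: 'b"
  have "finite ?P"
    by (rule finite_subset[OF _ finite_permutations[OF finite_vertices[OF assms]]]) auto
  then have "(\<Sum>p\<in>?P. perm_weight E p :: 'b) =
      (\<Sum>U\<in>Pow T. \<Sum>p\<in>{p \<in> ?P. (\<Union>v\<in>moved p. labels v) = U}. perm_weight E p)"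
    by (intro sum.group[symmetric])
      (use assms moved_subset in \<open>fastforce simp: vertices_def\<close>)+
  also have "\<dots> = (\<Sum>U\<in>Pow T. spanning_sum r U)"
  proof (rule sum.cong)
    fix U assume "U \<in> Pow T"
    then have sub: "vertices U \<subseteq> vertices T"
      by (auto simp: vertices_def)
    have "p permutes vertices U"
      if p: "p permutes vertices T" and U: "(\<Union>v\<in>moved p. labels v) = U" for p
      by (rule permutes_superset[OF p])
        (use moved_subset[OF p] U in \<open>auto simp: vertices_def moved_def\<close>)
    with permutes_subset[OF _ sub]
    have "{p \<in> ?P. (\<Union>v\<in>moved p. labels v) = U} = spanning_perms r U"
      by (auto simp: spanning_perms_def)
    then show "(\<Sum>p\<in>{p \<in> ?P. (\<Union>v\<in>moved p. labels v) = U}. perm_weight E p) =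
        (spanning_sum r U :: 'b)"
      by (simp add: spanning_sum_def)
  qed simp
  also have "\<dots> = (\<Sum>U\<in>Pow T. spanning_sum r {1..card U})"
    by (intro sum.cong refl spanning_sum_card) (use assms finite_subset in blast)
  also have "\<dots> = (\<Sum>m\<le>card T. ?f m)"
    by (rule sum_Pow_card[OF assms])
  \<comment> \<open>Terms with \<open>m > card T\<close> vanish by the binomial coefficient, those with \<open>m > r * k\<close> by
    \<open>spanning_sum_eq_0\<close>; so both ranges can be exchanged through a common larger one.\<close>
  also have "\<dots> = (\<Sum>m\<le>card T + r * k. ?f m)"
    by (rule sum.mono_neutral_left) (auto simp: binomial_eq_0)
  also have "\<dots> = (\<Sum>m\<le>r * k. ?f m)"
    by (rule sum.mono_neutral_right) (auto simp: spanning_sum_eq_0)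
  finally show ?thesis .
qed

lemma two_level_polynomial_char_poly:
  assumes verts: "\<And>q. pverts (G q) = vertices {1..q}"
    and arcs: "\<And>q. parcs (G q) = E \<inter> (vertices {1..q} \<times> vertices {1..q})"
    and num: "numerical_polynomial g"
    and g: "\<And>q. poly g (of_nat q) = of_nat (card (pverts (G q)))"
  shows "two_level_polynomial g (\<lambda>_. \<infinity>) (\<lambda>q. graph_char_poly (G q))"
proof -
  define \<phi> where "\<phi> r = (\<Sum>m\<le>r * k. Polynomial.smult (spanning_sum r {1..m}) (binomial_poly m))" for r
  have fin: "finite (pverts (G q))" for q
    by (simp add: verts finite_vertices)
  have "codeg_coeff (graph_char_poly (G q)) r = poly (\<phi> r) (of_nat q)" for q r
  proof -
    have "codeg_coeff (graph_char_poly (G q)) r =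
        (\<Sum>p | p permutes vertices {1..q} \<and> card (moved p) = r. perm_weight (parcs (G q)) p :: rat)"
      unfolding verts[symmetric]
      by (rule codeg_coeff_graph_char_poly[OF fin]) (simp add: arcs loopless)
    also have "\<dots> = (\<Sum>p | p permutes vertices {1..q} \<and> card (moved p) = r. perm_weight E p)"
    proof (rule sum.cong)
      fix p assume "p \<in> {p. p permutes vertices {1..q} \<and> card (moved p) = r}"
      then have p: "p permutes vertices {1..q}"
        by simp
      have "(v, p v) \<in> parcs (G q) \<longleftrightarrow> (v, p v) \<in> E" if "v \<in> moved p" for v
        using moved_subset[OF p] that p by (auto simp: arcs permutes_in_image)
      then show "perm_weight (parcs (G q)) p = (perm_weight E p :: rat)"
        by (simp add: perm_weight_def cong: prod.cong)
    qed simp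
    also have "\<dots> = (\<Sum>m\<le>r * k. of_nat (q choose m) * spanning_sum r {1..m})"
      by (subst sum_perm_weight_vertices) simp_all
    also have "\<dots> = poly (\<phi> r) (of_nat q)"
      by (simp add: \<phi>_def poly_sum poly_binomial_poly_of_nat mult.commute)
    finally show ?thesis .
  qed
  then show ?thesis
    using num g degree_graph_char_poly[OF fin, where 'a = rat]
    by (auto simp: two_level_polynomial_def)
qed

end

section \<open>The three families\<close>

lemma numerical_monom: "numerical_polynomial (monom 1 k)"
  by (simp add: numerical_polynomial_def poly_monom)

text \<open>Kneser graphs are the case \<open>R c \<longleftrightarrow> c = 0\<close>, Johnson graphs the case \<open>R c \<longleftrightarrow> c = k - 1\<close>. The
  assumption excludes loops, as a set of size \<open>k\<close> meets itself in \<open>k\<close> elements.\<close>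

lemma labelled_relation_subsets:
  assumes "\<not> R k"
  shows "labelled_relation {A. card A = k}
    {(A, B). card A = k \<and> card B = k \<and> R (card (A \<inter> B))} (\<lambda>A. A) image k"
proof
  fix U :: "nat set" assume "finite U"
  then show "finite {A \<in> {A. card A = k}. A \<subseteq> U}"
    by simp
next
  fix \<sigma> :: "nat \<Rightarrow> nat" and A :: "nat set"
  assume \<sigma>: "bij \<sigma>"
  then have inj: "inj \<sigma>"
    by (rule bij_is_inj)
  then have [simp]: "card (\<sigma> ` A) = card A" for A
    by (simp add: card_image inj_on_subset)
  show "\<sigma> ` A \<in> {A. card A = k}" if "A \<in> {A. card A = k}"
    using that by simp
  show "inv_into UNIV \<sigma> ` \<sigma> ` A = A"
    using inj by (simp add: image_comp)
  show "(\<sigma> ` A, \<sigma> ` B) \<in> {(A, B). card A = k \<and> card B = k \<and> R (card (A \<inter> B))} \<longleftrightarrow>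
      (A, B) \<in> {(A, B). card A = k \<and> card B = k \<and> R (card (A \<inter> B))}" for B
    by (simp add: image_Int[OF inj, symmetric])
qed (use assms in auto)

lemma labelled_relation_tuples:
  "labelled_relation {xs. length xs = k}
    {(xs, ys). length xs = k \<and> length ys = k \<and> card {i. i < k \<and> xs ! i \<noteq> ys ! i} = 1} set map k"
proof
  fix U :: "nat set" assume "finite U"
  then show "finite {xs \<in> {xs. length xs = k}. set xs \<subseteq> U}"
    using finite_lists_length_eq[of U k] by (simp add: conj_commute)
next
  fix \<sigma> :: "nat \<Rightarrow> nat" and xs ys :: "nat list"
  assume \<sigma>: "bij \<sigma>"
  then have inj: "inj \<sigma>"
    by (rule bij_is_inj)
  then show "map (inv_into UNIV \<sigma>) (map \<sigma> xs) = xs"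
    by simp
  assume "xs \<in> {xs. length xs = k}" "ys \<in> {xs. length xs = k}"
  moreover from this have "{i. i < k \<and> map \<sigma> xs ! i \<noteq> map \<sigma> ys ! i} = {i. i < k \<and> xs ! i \<noteq> ys ! i}"
    by (auto simp: inj_eq[OF inj])
  ultimately show
    "(map \<sigma> xs, map \<sigma> ys) \<in> {(xs, ys). length xs = k \<and> length ys = k \<and>
       card {i. i < k \<and> xs ! i \<noteq> ys ! i} = 1} \<longleftrightarrow>
     (xs, ys) \<in> {(xs, ys). length xs = k \<and> length ys = k \<and> card {i. i < k \<and> xs ! i \<noteq> ys ! i} = 1}"
    by simp
qed (auto simp: card_length)

theorem corollary35:
  fixes k :: nat
  assumes "k \<ge> 1"
  shows
    "(\<exists>g. (\<forall>q. poly g (of_nat q) = of_nat (card (pverts (kneser_graph q k)))) \<and>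
        two_level_polynomial g (\<lambda>_. \<infinity>) (\<lambda>q. graph_char_poly (kneser_graph q k))) \<and>
     (\<exists>g. (\<forall>q. poly g (of_nat q) = of_nat (card (pverts (johnson_graph q k)))) \<and>
        two_level_polynomial g (\<lambda>_. \<infinity>) (\<lambda>q. graph_char_poly (johnson_graph q k))) \<and>
     (\<exists>g. (\<forall>q. poly g (of_nat q) = of_nat (card (pverts (complete_graph_power q k)))) \<and>
        two_level_polynomial g (\<lambda>_. \<infinity>) (\<lambda>q. graph_char_poly (complete_graph_power q k)))"
proof (intro conjI)
  have choose: "poly (binomial_poly k) (of_nat q) = of_nat (card {A. A \<subseteq> {1..q} \<and> card A = k})" for q
    by (simp add: poly_binomial_poly_of_nat n_subsets)
  let ?K = "\<lambda>c. c = 0" and ?J = "\<lambda>c. c = k - 1"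
  interpret K: labelled_relation "{A. card A = k}"
    "{(A, B). card A = k \<and> card B = k \<and> ?K (card (A \<inter> B))}" "\<lambda>A. A" image k
    by (rule labelled_relation_subsets) (use assms in auto)
  have disjoint: "A \<inter> B = {} \<longleftrightarrow> card (A \<inter> B) = 0" if "A \<subseteq> {1..q}" for A B and q :: nat
    using finite_subset[OF that] by simp
  have "two_level_polynomial (binomial_poly k) (\<lambda>_. \<infinity>) (\<lambda>q. graph_char_poly (kneser_graph q k))"
    by (rule K.two_level_polynomial_char_poly[OF _ _ numerical_binomial_poly])
      (use disjoint in \<open>auto simp: kneser_graph_def K.vertices_def choose\<close>)
  then show "\<exists>g. (\<forall>q. poly g (of_nat q) = of_nat (card (pverts (kneser_graph q k)))) \<and>
      two_level_polynomial g (\<lambda>_. \<infinity>) (\<lambda>q. graph_char_poly (kneser_graph q k))"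
    using choose by (auto simp: kneser_graph_def)
  interpret J: labelled_relation "{A. card A = k}"
    "{(A, B). card A = k \<and> card B = k \<and> ?J (card (A \<inter> B))}" "\<lambda>A. A" image k
    by (rule labelled_relation_subsets) (use assms in auto)
  have "two_level_polynomial (binomial_poly k) (\<lambda>_. \<infinity>) (\<lambda>q. graph_char_poly (johnson_graph q k))"
    by (rule J.two_level_polynomial_char_poly[OF _ _ numerical_binomial_poly])
      (auto simp: johnson_graph_def J.vertices_def choose)
  then show "\<exists>g. (\<forall>q. poly g (of_nat q) = of_nat (card (pverts (johnson_graph q k)))) \<and>
      two_level_polynomial g (\<lambda>_. \<infinity>) (\<lambda>q. graph_char_poly (johnson_graph q k))"
    using choose by (auto simp: johnson_graph_def)
  interpret P: labelled_relation "{xs. length xs = k}"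
    "{(xs, ys). length xs = k \<and> length ys = k \<and> card {i. i < k \<and> xs ! i \<noteq> ys ! i} = 1}" set map k
    by (rule labelled_relation_tuples)
  have power: "poly (monom 1 k) (of_nat q) = (of_nat (card (pverts (complete_graph_power q k))) :: rat)"
    for q
    by (simp add: complete_graph_power_def poly_monom card_lists_length_eq)
  have "two_level_polynomial (monom 1 k) (\<lambda>_. \<infinity>) (\<lambda>q. graph_char_poly (complete_graph_power q k))"
    by (rule P.two_level_polynomial_char_poly[OF _ _ numerical_monom power])
      (auto simp: complete_graph_power_def P.vertices_def)
  with power show "\<exists>g. (\<forall>q. poly g (of_nat q) = of_nat (card (pverts (complete_graph_power q k)))) \<and>
      two_level_polynomial g (\<lambda>_. \<infinity>) (\<lambda>q. graph_char_poly (complete_graph_power q k))"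
    by blast
qed

end
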